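(* Let $G$ be a finite group, $p$ a prime, and $k$ a field of characteristic $p$. Let $S, S_1, S_2, T, V_0, V_1, V_2$ be finitely generated $kG$-modules, and suppose there exist short exact sequences of $kG$-modules $$0\to S_1\xrightarrow{\alpha_0} V_0\xrightarrow{\beta_0} S\to 0,$$ $$0\to S_1\xrightarrow{\alpha_1} V_1\xrightarrow{\beta_1} S_2\to 0,$$ $$0\to T\xrightarrow{\alpha_2} V_2\xrightarrow{\beta_2} S_2\to 0.$$ Then there exists a long exact sequence of $kG$-modules $$0\to T\to W_2\to W_1\to S\to 0,$$ where $W_1$ is the pushout of $(S_1,V_0,V_1)$, i.e. of the maps $\alpha_0:S_1\to V_0$ and $\alpha_1:S_1\to V_1$, and $W_2$ is the pullback of $(S_2,V_1,V_2)$, i.e. of the maps $\beta_1:V_1\to S_2$ and $\beta_2:V_2\to S_2$.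
   Context: All $kG$-modules are finitely generated. Explicitly, the pushout is $W_1=(V_0\oplus V_1)/\{(\alpha_0(t),-\alpha_1(t)) : t\in S_1\}$ and the pullback is $W_2=\{(y,z)\in V_1\oplus V_2 : \beta_1(y)=\beta_2(z)\}$. *)

theory Defs
  imports "HOL-Algebra.AbelCoset" "HOL-Algebra.Module" "HOL-Computational_Algebra.Primes"
begin

definition ring_char :: "('a, 'm) ring_scheme \<Rightarrow> nat"
  where "ring_char R = Gcd {n::nat. [n] \<cdot>\<^bsub>R\<^esub> \<one>\<^bsub>R\<^esub> = \<zero>\<^bsub>R\<^esub>}"

text \<open>
  The group algebra: for a finite group every function from \<open>G\<close> to \<open>k\<close> is finitely supported,
  and the function \<open>a\<close> stands for the formal sum of the \<open>a g \<cdot> g\<close>, so that the product is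
  convolution. Functions are extensional, which makes the representation unique.
\<close>

definition group_algebra :: "('k, 'm) ring_scheme \<Rightarrow> ('g, 'n) monoid_scheme \<Rightarrow> ('g \<Rightarrow> 'k) ring"
  where "group_algebra k G =
    \<lparr>carrier = carrier G \<rightarrow>\<^sub>E carrier k,
     monoid.mult = (\<lambda>a b. \<lambda>g\<in>carrier G. \<Oplus>\<^bsub>k\<^esub>h\<in>carrier G. a h \<otimes>\<^bsub>k\<^esub> b (inv\<^bsub>G\<^esub> h \<otimes>\<^bsub>G\<^esub> g)),
     monoid.one = (\<lambda>g\<in>carrier G. if g = \<one>\<^bsub>G\<^esub> then \<one>\<^bsub>k\<^esub> else \<zero>\<^bsub>k\<^esub>),
     ring.zero = (\<lambda>g\<in>carrier G. \<zero>\<^bsub>k\<^esub>),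
     ring.add = (\<lambda>a b. \<lambda>g\<in>carrier G. a g \<oplus>\<^bsub>k\<^esub> b g)\<rparr>"

lemma (in abelian_monoid) finsum_swap:
  assumes "finite A" "finite B" "\<And>x y. x \<in> A \<Longrightarrow> y \<in> B \<Longrightarrow> f x y \<in> carrier G"
  shows "(\<Oplus>x\<in>A. \<Oplus>y\<in>B. f x y) = (\<Oplus>y\<in>B. \<Oplus>x\<in>A. f x y)"
  using assms(1,3)
proof (induction A)
  case empty
  then show ?case by simp
next
  case (insert a A)
  have "(\<Oplus>y\<in>B. \<Oplus>x\<in>insert a A. f x y) = (\<Oplus>y\<in>B. f a y \<oplus> (\<Oplus>x\<in>A. f x y))"
    by (intro finsum_cong' refl) (use insert in \<open>auto intro!: finsum_insert\<close>)
  also have "\<dots> = (\<Oplus>y\<in>B. f a y) \<oplus> (\<Oplus>y\<in>B. \<Oplus>x\<in>A. f x y)"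
    by (intro finsum_addf) (use insert in auto)
  also have "\<dots> = (\<Oplus>x\<in>insert a A. \<Oplus>y\<in>B. f x y)"
    using insert by (subst finsum_insert) (auto simp: Pi_def)
  finally show ?case by simp
qed

lemma ring_group_algebra:
  assumes "ring k" "group G" "finite (carrier G)"
  shows "ring (group_algebra k G)"
proof -
  interpret k: ring k by fact
  interpret G: group G by fact
  note fin = \<open>finite (carrier G)\<close>
  let ?KG = "carrier G \<rightarrow>\<^sub>E carrier k"
  define conv where "conv = (\<lambda>a b g. \<Oplus>\<^bsub>k\<^esub>h\<in>carrier G. a h \<otimes>\<^bsub>k\<^esub> b (inv\<^bsub>G\<^esub> h \<otimes>\<^bsub>G\<^esub> g))"
  have memK [simp]: "a g \<in> carrier k" if "a \<in> ?KG" "g \<in> carrier G" for a g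
    using that by auto
  have conv_closed [simp]: "conv a b g \<in> carrier k" if "a \<in> ?KG" "b \<in> ?KG" "g \<in> carrier G" for a b g
    unfolding conv_def using that by (intro k.finsum_closed) auto
  have mult: "a \<otimes>\<^bsub>group_algebra k G\<^esub> b = restrict (conv a b) (carrier G)" for a b
    by (simp add: group_algebra_def conv_def)
  have sel [simp]: "carrier (group_algebra k G) = ?KG"
    "\<one>\<^bsub>group_algebra k G\<^esub> = (\<lambda>g\<in>carrier G. if g = \<one>\<^bsub>G\<^esub> then \<one>\<^bsub>k\<^esub> else \<zero>\<^bsub>k\<^esub>)"
    "\<zero>\<^bsub>group_algebra k G\<^esub> = (\<lambda>g\<in>carrier G. \<zero>\<^bsub>k\<^esub>)"
    "a \<oplus>\<^bsub>group_algebra k G\<^esub> b = (\<lambda>g\<in>carrier G. a g \<oplus>\<^bsub>k\<^esub> b g)" for a b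
    by (simp_all add: group_algebra_def)
  have ext: "a = b" if "a \<in> ?KG" "b \<in> ?KG" "\<And>g. g \<in> carrier G \<Longrightarrow> a g = b g" for a b
    using that by (intro PiE_ext) auto
  have shift: "(\<Oplus>\<^bsub>k\<^esub>h\<in>carrier G. f h) = (\<Oplus>\<^bsub>k\<^esub>m\<in>carrier G. f (l \<otimes>\<^bsub>G\<^esub> m))"
    if "l \<in> carrier G" "f \<in> carrier G \<rightarrow> carrier k" for l f
  proof -
    have im: "(\<otimes>\<^bsub>G\<^esub>) l ` carrier G = carrier G"
      using that(1) by (auto simp: image_iff) (metis G.inv_closed G.inv_solve_left G.m_closed)
    have inj: "inj_on ((\<otimes>\<^bsub>G\<^esub>) l) (carrier G)"
      using that(1) by (auto simp: inj_on_def)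
    show ?thesis
      using k.finsum_reindex[of f "(\<otimes>\<^bsub>G\<^esub>) l" "carrier G"] im inj that by simp
  qed
  have assoc: "conv (restrict (conv a b) (carrier G)) c g
      = conv a (restrict (conv b c) (carrier G)) g" (is "?L = ?R")
    if [simp]: "a \<in> ?KG" "b \<in> ?KG" "c \<in> ?KG" "g \<in> carrier G" for a b c g
  proof -
    have "?L = (\<Oplus>\<^bsub>k\<^esub>h\<in>carrier G. \<Oplus>\<^bsub>k\<^esub>l\<in>carrier G.
        a l \<otimes>\<^bsub>k\<^esub> b (inv\<^bsub>G\<^esub> l \<otimes>\<^bsub>G\<^esub> h) \<otimes>\<^bsub>k\<^esub> c (inv\<^bsub>G\<^esub> h \<otimes>\<^bsub>G\<^esub> g))"
      unfolding conv_def
      by (rule k.finsum_cong'[OF refl]) (auto simp: k.finsum_ldistr fin Pi_def)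
    also have "\<dots> = (\<Oplus>\<^bsub>k\<^esub>l\<in>carrier G. \<Oplus>\<^bsub>k\<^esub>h\<in>carrier G.
        a l \<otimes>\<^bsub>k\<^esub> b (inv\<^bsub>G\<^esub> l \<otimes>\<^bsub>G\<^esub> h) \<otimes>\<^bsub>k\<^esub> c (inv\<^bsub>G\<^esub> h \<otimes>\<^bsub>G\<^esub> g))"
      by (intro k.finsum_swap) (auto simp: fin)
    also have "\<dots> = (\<Oplus>\<^bsub>k\<^esub>l\<in>carrier G. \<Oplus>\<^bsub>k\<^esub>m\<in>carrier G.
        a l \<otimes>\<^bsub>k\<^esub> (b m \<otimes>\<^bsub>k\<^esub> c (inv\<^bsub>G\<^esub> m \<otimes>\<^bsub>G\<^esub> (inv\<^bsub>G\<^esub> l \<otimes>\<^bsub>G\<^esub> g))))"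
    proof (rule k.finsum_cong'[OF refl])
      fix l assume [simp]: "l \<in> carrier G"
      show "(\<Oplus>\<^bsub>k\<^esub>h\<in>carrier G. a l \<otimes>\<^bsub>k\<^esub> b (inv\<^bsub>G\<^esub> l \<otimes>\<^bsub>G\<^esub> h) \<otimes>\<^bsub>k\<^esub> c (inv\<^bsub>G\<^esub> h \<otimes>\<^bsub>G\<^esub> g))
        = (\<Oplus>\<^bsub>k\<^esub>m\<in>carrier G. a l \<otimes>\<^bsub>k\<^esub> (b m \<otimes>\<^bsub>k\<^esub> c (inv\<^bsub>G\<^esub> m \<otimes>\<^bsub>G\<^esub> (inv\<^bsub>G\<^esub> l \<otimes>\<^bsub>G\<^esub> g))))"
        by (subst shift[of l], simp, force, rule k.finsum_cong'[OF refl])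
          (auto simp: G.m_assoc[symmetric] G.inv_mult_group k.m_assoc)
    qed auto
    also have "\<dots> = ?R"
      unfolding conv_def
      by (rule k.finsum_cong'[OF refl]) (auto simp: k.finsum_rdistr fin Pi_def)
    finally show ?thesis .
  qed
  have one_l: "conv (\<lambda>g\<in>carrier G. if g = \<one>\<^bsub>G\<^esub> then \<one>\<^bsub>k\<^esub> else \<zero>\<^bsub>k\<^esub>) a g = a g"
    if [simp]: "a \<in> ?KG" "g \<in> carrier G" for a g
  proof -
    have "conv (\<lambda>g\<in>carrier G. if g = \<one>\<^bsub>G\<^esub> then \<one>\<^bsub>k\<^esub> else \<zero>\<^bsub>k\<^esub>) a g
        = (\<Oplus>\<^bsub>k\<^esub>h\<in>carrier G. if \<one>\<^bsub>G\<^esub> = h then a (inv\<^bsub>G\<^esub> h \<otimes>\<^bsub>G\<^esub> g) else \<zero>\<^bsub>k\<^esub>)"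
      unfolding conv_def by (rule k.finsum_cong'[OF refl]) auto
    also have "\<dots> = a g"
      by (subst k.finsum_singleton) (auto simp: fin)
    finally show ?thesis .
  qed
  have one_r: "conv a (\<lambda>g\<in>carrier G. if g = \<one>\<^bsub>G\<^esub> then \<one>\<^bsub>k\<^esub> else \<zero>\<^bsub>k\<^esub>) g = a g"
    if [simp]: "a \<in> ?KG" "g \<in> carrier G" for a g
  proof -
    have inv_iff: "inv\<^bsub>G\<^esub> h \<otimes>\<^bsub>G\<^esub> g = \<one>\<^bsub>G\<^esub> \<longleftrightarrow> g = h" if "h \<in> carrier G" for h
      using that \<open>g \<in> carrier G\<close> by (metis G.inv_closed G.inv_equality G.inv_inv G.l_inv)
    have "conv a (\<lambda>g\<in>carrier G. if g = \<one>\<^bsub>G\<^esub> then \<one>\<^bsub>k\<^esub> else \<zero>\<^bsub>k\<^esub>) g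
        = (\<Oplus>\<^bsub>k\<^esub>h\<in>carrier G. if g = h then a h else \<zero>\<^bsub>k\<^esub>)"
      unfolding conv_def by (rule k.finsum_cong'[OF refl]) (auto simp: inv_iff)
    also have "\<dots> = a g"
      by (subst k.finsum_singleton) (auto simp: fin)
    finally show ?thesis .
  qed
  have dist_l: "conv (\<lambda>g\<in>carrier G. a g \<oplus>\<^bsub>k\<^esub> b g) c g = conv a c g \<oplus>\<^bsub>k\<^esub> conv b c g"
    if [simp]: "a \<in> ?KG" "b \<in> ?KG" "c \<in> ?KG" "g \<in> carrier G" for a b c g
  proof -
    have "conv (\<lambda>g\<in>carrier G. a g \<oplus>\<^bsub>k\<^esub> b g) c g = (\<Oplus>\<^bsub>k\<^esub>h\<in>carrier G.
        a h \<otimes>\<^bsub>k\<^esub> c (inv\<^bsub>G\<^esub> h \<otimes>\<^bsub>G\<^esub> g) \<oplus>\<^bsub>k\<^esub> b h \<otimes>\<^bsub>k\<^esub> c (inv\<^bsub>G\<^esub> h \<otimes>\<^bsub>G\<^esub> g))"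
      unfolding conv_def by (rule k.finsum_cong'[OF refl]) (simp_all add: Pi_def k.l_distr)
    also have "\<dots> = conv a c g \<oplus>\<^bsub>k\<^esub> conv b c g"
      unfolding conv_def by (rule k.finsum_addf) (simp_all add: Pi_def)
    finally show ?thesis .
  qed
  have dist_r: "conv c (\<lambda>g\<in>carrier G. a g \<oplus>\<^bsub>k\<^esub> b g) g = conv c a g \<oplus>\<^bsub>k\<^esub> conv c b g"
    if [simp]: "a \<in> ?KG" "b \<in> ?KG" "c \<in> ?KG" "g \<in> carrier G" for a b c g
  proof -
    have "conv c (\<lambda>g\<in>carrier G. a g \<oplus>\<^bsub>k\<^esub> b g) g = (\<Oplus>\<^bsub>k\<^esub>h\<in>carrier G.
        c h \<otimes>\<^bsub>k\<^esub> a (inv\<^bsub>G\<^esub> h \<otimes>\<^bsub>G\<^esub> g) \<oplus>\<^bsub>k\<^esub> c h \<otimes>\<^bsub>k\<^esub> b (inv\<^bsub>G\<^esub> h \<otimes>\<^bsub>G\<^esub> g))"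
      unfolding conv_def by (rule k.finsum_cong'[OF refl]) (simp_all add: Pi_def k.r_distr)
    also have "\<dots> = conv c a g \<oplus>\<^bsub>k\<^esub> conv c b g"
      unfolding conv_def by (rule k.finsum_addf) (simp_all add: Pi_def)
    finally show ?thesis .
  qed
  have mem: "restrict f (carrier G) \<in> ?KG" if "\<And>g. g \<in> carrier G \<Longrightarrow> f g \<in> carrier k" for f
    using that by auto
  have abelian: "abelian_group (group_algebra k G)"
  proof (intro abelian_groupI; unfold sel)
    show "(\<lambda>g\<in>carrier G. \<zero>\<^bsub>k\<^esub>) \<in> ?KG"
      by (intro mem) simp
  next
    fix a b c assume [simp]: "a \<in> ?KG" "b \<in> ?KG" "c \<in> ?KG"
    show "(\<lambda>g\<in>carrier G. a g \<oplus>\<^bsub>k\<^esub> b g) \<in> ?KG"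
      by (intro mem) simp
    show "(\<lambda>g\<in>carrier G. (\<lambda>g\<in>carrier G. a g \<oplus>\<^bsub>k\<^esub> b g) g \<oplus>\<^bsub>k\<^esub> c g)
        = (\<lambda>g\<in>carrier G. a g \<oplus>\<^bsub>k\<^esub> (\<lambda>g\<in>carrier G. b g \<oplus>\<^bsub>k\<^esub> c g) g)"
      by (intro restrict_ext) (simp add: k.a_assoc)
    show "(\<lambda>g\<in>carrier G. a g \<oplus>\<^bsub>k\<^esub> b g) = (\<lambda>g\<in>carrier G. b g \<oplus>\<^bsub>k\<^esub> a g)"
      by (intro restrict_ext) (simp add: k.a_comm)
    show "(\<lambda>g\<in>carrier G. (\<lambda>g\<in>carrier G. \<zero>\<^bsub>k\<^esub>) g \<oplus>\<^bsub>k\<^esub> a g) = a"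
      by (intro ext mem) simp_all
    show "\<exists>b\<in>?KG. (\<lambda>g\<in>carrier G. b g \<oplus>\<^bsub>k\<^esub> a g) = (\<lambda>g\<in>carrier G. \<zero>\<^bsub>k\<^esub>)"
      by (rule bexI[of _ "\<lambda>g\<in>carrier G. \<ominus>\<^bsub>k\<^esub> a g"], intro restrict_ext, simp add: k.l_neg,
          intro mem, simp)
  qed
  have monoid: "monoid (group_algebra k G)"
  proof (intro monoidI; unfold sel mult)
    show "(\<lambda>g\<in>carrier G. if g = \<one>\<^bsub>G\<^esub> then \<one>\<^bsub>k\<^esub> else \<zero>\<^bsub>k\<^esub>) \<in> ?KG"
      by (intro mem) simp
  next
    fix a b c assume [simp]: "a \<in> ?KG" "b \<in> ?KG" "c \<in> ?KG"
    show "restrict (conv a b) (carrier G) \<in> ?KG"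
      by (intro mem) simp
    show "restrict (conv (restrict (conv a b) (carrier G)) c) (carrier G)
        = restrict (conv a (restrict (conv b c) (carrier G))) (carrier G)"
      by (intro restrict_ext assoc) simp_all
    show "restrict (conv (\<lambda>g\<in>carrier G. if g = \<one>\<^bsub>G\<^esub> then \<one>\<^bsub>k\<^esub> else \<zero>\<^bsub>k\<^esub>) a) (carrier G) = a"
      by (intro ext mem) (simp_all add: one_l)
    show "restrict (conv a (\<lambda>g\<in>carrier G. if g = \<one>\<^bsub>G\<^esub> then \<one>\<^bsub>k\<^esub> else \<zero>\<^bsub>k\<^esub>)) (carrier G) = a"
      by (intro ext mem) (simp_all add: one_r)
  qed
  show ?thesis
  proof (intro ringI abelian monoid; unfold sel mult)
    fix a b c assume [simp]: "a \<in> ?KG" "b \<in> ?KG" "c \<in> ?KG"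
    show "restrict (conv (\<lambda>g\<in>carrier G. a g \<oplus>\<^bsub>k\<^esub> b g) c) (carrier G)
        = (\<lambda>g\<in>carrier G. restrict (conv a c) (carrier G) g \<oplus>\<^bsub>k\<^esub> restrict (conv b c) (carrier G) g)"
      by (intro restrict_ext) (simp add: dist_l)
    show "restrict (conv c (\<lambda>g\<in>carrier G. a g \<oplus>\<^bsub>k\<^esub> b g)) (carrier G)
        = (\<lambda>g\<in>carrier G. restrict (conv c a) (carrier G) g \<oplus>\<^bsub>k\<^esub> restrict (conv c b) (carrier G) g)"
      by (intro restrict_ext) (simp add: dist_r)
  qed
qed

text \<open>
  The library's \<open>module\<close> locale with the commutativity of the scalar ring dropped. As there, the
  \<open>mult\<close> and \<open>one\<close> fields of the record \<open>M\<close> carry no meaning.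
\<close>

locale left_module = R?: ring R + M?: abelian_group M
  for R :: "('r, 'm) ring_scheme" (structure) and M :: "('r, 'a, 'n) module_scheme" (structure) +
  assumes smult_closed [simp, intro]:
      "\<lbrakk>r \<in> carrier R; x \<in> carrier M\<rbrakk> \<Longrightarrow> r \<odot>\<^bsub>M\<^esub> x \<in> carrier M"
    and smult_l_distr:
      "\<lbrakk>r \<in> carrier R; s \<in> carrier R; x \<in> carrier M\<rbrakk> \<Longrightarrow>
        (r \<oplus> s) \<odot>\<^bsub>M\<^esub> x = r \<odot>\<^bsub>M\<^esub> x \<oplus>\<^bsub>M\<^esub> s \<odot>\<^bsub>M\<^esub> x"
    and smult_r_distr:
      "\<lbrakk>r \<in> carrier R; x \<in> carrier M; y \<in> carrier M\<rbrakk> \<Longrightarrow>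
        r \<odot>\<^bsub>M\<^esub> (x \<oplus>\<^bsub>M\<^esub> y) = r \<odot>\<^bsub>M\<^esub> x \<oplus>\<^bsub>M\<^esub> r \<odot>\<^bsub>M\<^esub> y"
    and smult_assoc1:
      "\<lbrakk>r \<in> carrier R; s \<in> carrier R; x \<in> carrier M\<rbrakk> \<Longrightarrow>
        (r \<otimes> s) \<odot>\<^bsub>M\<^esub> x = r \<odot>\<^bsub>M\<^esub> (s \<odot>\<^bsub>M\<^esub> x)"
    and smult_one [simp]:
      "x \<in> carrier M \<Longrightarrow> \<one> \<odot>\<^bsub>M\<^esub> x = x"

definition fg_left_module :: "('r, 'm) ring_scheme \<Rightarrow> ('r, 'a, 'n) module_scheme \<Rightarrow> bool"
  where "fg_left_module R M \<longleftrightarrow> left_module R M \<and>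
    (\<exists>X. finite X \<and> X \<subseteq> carrier M \<and> (\<forall>N. submodule N R M \<longrightarrow> X \<subseteq> N \<longrightarrow> N = carrier M))"

definition left_module_hom ::
    "('r, 'm) ring_scheme \<Rightarrow> ('r, 'a, 'n) module_scheme \<Rightarrow> ('r, 'b, 'l) module_scheme \<Rightarrow> ('a \<Rightarrow> 'b) set"
  where "left_module_hom R M N = {f \<in> hom (add_monoid M) (add_monoid N).
    \<forall>r\<in>carrier R. \<forall>x\<in>carrier M. f (r \<odot>\<^bsub>M\<^esub> x) = r \<odot>\<^bsub>N\<^esub> f x}"

definition exact_at ::
    "('r, 'a, 'l) module_scheme \<Rightarrow> ('a \<Rightarrow> 'b) \<Rightarrow> ('r, 'b, 'm) module_scheme \<Rightarrow> ('b \<Rightarrow> 'c)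
      \<Rightarrow> ('r, 'c, 'n) module_scheme \<Rightarrow> bool"
  where "exact_at A f B g C \<longleftrightarrow> f ` carrier A = a_kernel B C g"

text \<open>
  The sequences \<open>0 \<rightarrow> A \<rightarrow> B \<rightarrow> C \<rightarrow> 0\<close> and \<open>0 \<rightarrow> A \<rightarrow> B \<rightarrow> C \<rightarrow> D \<rightarrow> 0\<close>. Exactness at the two outer
  terms is spelled out with the image of \<open>0 \<rightarrow> A\<close> and the kernel of the last map to \<open>0\<close>.
\<close>

definition short_exact ::
    "('r, 'k) ring_scheme \<Rightarrow> ('r, 'a, 'l) module_scheme \<Rightarrow> ('a \<Rightarrow> 'b) \<Rightarrow> ('r, 'b, 'm) module_scheme
      \<Rightarrow> ('b \<Rightarrow> 'c) \<Rightarrow> ('r, 'c, 'n) module_scheme \<Rightarrow> bool"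
  where "short_exact R A f B g C \<longleftrightarrow>
    f \<in> left_module_hom R A B \<and> g \<in> left_module_hom R B C \<and>
    {\<zero>\<^bsub>A\<^esub>} = a_kernel A B f \<and> exact_at A f B g C \<and> g ` carrier B = carrier C"

definition long_exact4 ::
    "('r, 'k) ring_scheme \<Rightarrow> ('r, 'a, 'l) module_scheme \<Rightarrow> ('a \<Rightarrow> 'b) \<Rightarrow> ('r, 'b, 'm) module_scheme
      \<Rightarrow> ('b \<Rightarrow> 'c) \<Rightarrow> ('r, 'c, 'n) module_scheme \<Rightarrow> ('c \<Rightarrow> 'd) \<Rightarrow> ('r, 'd, 'o) module_scheme \<Rightarrow> bool"
  where "long_exact4 R A f B g C h D \<longleftrightarrow>
    f \<in> left_module_hom R A B \<and> g \<in> left_module_hom R B C \<and> h \<in> left_module_hom R C D \<and>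
    {\<zero>\<^bsub>A\<^esub>} = a_kernel A B f \<and> exact_at A f B g C \<and> exact_at B g C h D \<and>
    h ` carrier C = carrier D"

definition module_sum ::
    "('r, 'a, 'm) module_scheme \<Rightarrow> ('r, 'b, 'n) module_scheme \<Rightarrow> ('r, 'a \<times> 'b) module"
  where "module_sum M N =
    \<lparr>carrier = carrier M \<times> carrier N,
     monoid.mult = undefined, monoid.one = undefined,
     ring.zero = (\<zero>\<^bsub>M\<^esub>, \<zero>\<^bsub>N\<^esub>),
     ring.add = (\<lambda>(x, y) (x', y'). (x \<oplus>\<^bsub>M\<^esub> x', y \<oplus>\<^bsub>N\<^esub> y')),
     module.smult = (\<lambda>r (x, y). (r \<odot>\<^bsub>M\<^esub> x, r \<odot>\<^bsub>N\<^esub> y))\<rparr>"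

text \<open>
  The scalar action on cosets follows the pattern of \<open>rcoset_mult\<close>: for a submodule \<open>N\<close>,
  all the cosets in the union agree.
\<close>

definition quotient_module ::
    "('r, 'a, 'm) module_scheme \<Rightarrow> 'a set \<Rightarrow> ('r, 'a set) module"
  where "quotient_module M N =
    \<lparr>carrier = a_rcosets\<^bsub>M\<^esub> N,
     monoid.mult = undefined, monoid.one = undefined,
     ring.zero = N,
     ring.add = set_add M,
     module.smult = (\<lambda>r X. \<Union>x\<in>X. N +>\<^bsub>M\<^esub> (r \<odot>\<^bsub>M\<^esub> x))\<rparr>"

definition module_pushout ::
    "('r, 's, 'l) module_scheme \<Rightarrow> ('r, 'a, 'm) module_scheme \<Rightarrow> ('r, 'b, 'n) module_scheme
      \<Rightarrow> ('s \<Rightarrow> 'a) \<Rightarrow> ('s \<Rightarrow> 'b) \<Rightarrow> ('r, ('a \<times> 'b) set) module"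
  where "module_pushout S V W \<alpha> \<beta> =
    quotient_module (module_sum V W) {(\<alpha> t, \<ominus>\<^bsub>W\<^esub> \<beta> t) | t. t \<in> carrier S}"

definition module_pullback ::
    "('r, 'a, 'm) module_scheme \<Rightarrow> ('r, 'b, 'n) module_scheme
      \<Rightarrow> ('a \<Rightarrow> 's) \<Rightarrow> ('b \<Rightarrow> 's) \<Rightarrow> ('r, 'a \<times> 'b) module"
  where "module_pullback V W \<alpha> \<beta> =
    (module_sum V W)\<lparr>carrier := {(y, z). y \<in> carrier V \<and> z \<in> carrier W \<and> \<alpha> y = \<beta> z}\<rparr>"

end

theory Submission
  imports Defs
begin

text \<open>
  The maps are \<open>t \<mapsto> (0, \<alpha>\<^sub>2 t)\<close>, \<open>(y, z) \<mapsto> [(0, y)]\<close> and \<open>[(x, y)] \<mapsto> \<beta>\<^sub>0 x\<close>.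
  The pushout is finitely generated as a quotient of \<open>V\<^sub>0 \<oplus> V\<^sub>1\<close>. The pullback is a submodule of
  \<open>V\<^sub>1 \<oplus> V\<^sub>2\<close>, but no Noetherian argument is needed: it is an extension
  \<open>0 \<rightarrow> S\<^sub>1 \<rightarrow> W\<^sub>2 \<rightarrow> V\<^sub>2 \<rightarrow> 0\<close> of finitely generated modules.
\<close>

section \<open>Elementary facts on left modules and their submodules\<close>

context left_module
begin

lemma module_minus_zero [simp]: "\<ominus>\<^bsub>M\<^esub> \<zero>\<^bsub>M\<^esub> = \<zero>\<^bsub>M\<^esub>"
  by (rule M.minus_equality) auto

lemma smult_r_null [simp]:
  assumes "r \<in> carrier R"
  shows "r \<odot>\<^bsub>M\<^esub> \<zero>\<^bsub>M\<^esub> = \<zero>\<^bsub>M\<^esub>"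
proof -
  have "r \<odot>\<^bsub>M\<^esub> \<zero>\<^bsub>M\<^esub> \<oplus>\<^bsub>M\<^esub> r \<odot>\<^bsub>M\<^esub> \<zero>\<^bsub>M\<^esub> = r \<odot>\<^bsub>M\<^esub> \<zero>\<^bsub>M\<^esub> \<oplus>\<^bsub>M\<^esub> \<zero>\<^bsub>M\<^esub>"
    using smult_r_distr[OF assms M.zero_closed M.zero_closed] assms by simp
  then show ?thesis
    using assms by simp
qed

lemma smult_r_minus:
  assumes "r \<in> carrier R" "x \<in> carrier M"
  shows "r \<odot>\<^bsub>M\<^esub> (\<ominus>\<^bsub>M\<^esub> x) = \<ominus>\<^bsub>M\<^esub> (r \<odot>\<^bsub>M\<^esub> x)"
proof (rule M.minus_equality[symmetric])
  show "r \<odot>\<^bsub>M\<^esub> (\<ominus>\<^bsub>M\<^esub> x) \<oplus>\<^bsub>M\<^esub> r \<odot>\<^bsub>M\<^esub> x = \<zero>\<^bsub>M\<^esub>"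
    using assms by (simp add: smult_r_distr[symmetric] M.l_neg)
qed (use assms in auto)

lemma submoduleI:
  assumes "H \<subseteq> carrier M" "\<zero>\<^bsub>M\<^esub> \<in> H" "\<And>x. x \<in> H \<Longrightarrow> \<ominus>\<^bsub>M\<^esub> x \<in> H"
    and "\<And>x y. x \<in> H \<Longrightarrow> y \<in> H \<Longrightarrow> x \<oplus>\<^bsub>M\<^esub> y \<in> H"
    and "\<And>r x. r \<in> carrier R \<Longrightarrow> x \<in> H \<Longrightarrow> r \<odot>\<^bsub>M\<^esub> x \<in> H"
  shows "submodule H R M"
  using assms by (intro submodule.intro subgroup.intro submodule_axioms.intro) (auto simp: a_inv_def)

lemma submodule_abelian_subgroup:
  assumes "submodule H R M"
  shows "abelian_subgroup H M"
  using assms M.abelian_group_axioms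
  by (intro abelian_subgroupI3 additive_subgroup.intro) (auto dest: submodule.axioms)

text \<open>A pullback is a direct sum with its carrier cut down, so this is what makes it a
  module.\<close>

lemma submodule_left_module:
  assumes "submodule H R M"
  shows "left_module R (M\<lparr>carrier := H\<rparr>)"
proof -
  interpret H: abelian_subgroup H M
    using assms by (rule submodule_abelian_subgroup)
  have sub: "\<And>x. x \<in> H \<Longrightarrow> x \<in> carrier M"
    using H.a_subset by blast
  have "abelian_group (M\<lparr>carrier := H\<rparr>)"
  proof (rule abelian_groupI; simp)
    show "\<exists>y\<in>H. y \<oplus>\<^bsub>M\<^esub> x = \<zero>\<^bsub>M\<^esub>" if "x \<in> H" for x
      using that by (intro bexI[of _ "\<ominus>\<^bsub>M\<^esub> x"]) (auto simp: sub M.l_neg)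
  qed (auto simp: sub M.a_assoc intro: M.a_comm)
  then show ?thesis
    by (intro left_module.intro left_module_axioms.intro R.ring_axioms)
      (auto simp: sub smult_l_distr smult_r_distr smult_assoc1 submodule.smult_closed[OF assms])
qed

end

section \<open>Module homomorphisms, images and preimages of submodules\<close>

locale left_module_map = A: left_module R A + B: left_module R B
  for R :: "('r, 'k) ring_scheme" and A :: "('r, 'a, 'l) module_scheme"
    and B :: "('r, 'b, 'm) module_scheme" and f :: "'a \<Rightarrow> 'b" +
  assumes left_module_hom: "f \<in> left_module_hom R A B"
begin

text \<open>The additive part of a module map is a group homomorphism. Preservation of zero, sums
  and negatives is inherited from there, and only \<open>hom_smult\<close> has to be added.\<close>

sublocale abelian_group_hom A B f
  using left_module_hom A.M.abelian_group_axioms B.M.abelian_group_axioms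
  by (intro abelian_group_homI)
    (auto simp: left_module_hom_def group_hom_def group_hom_axioms_def A.M.a_group B.M.a_group)

lemma hom_smult [simp]:
  "r \<in> carrier R \<Longrightarrow> x \<in> carrier A \<Longrightarrow> f (r \<odot>\<^bsub>A\<^esub> x) = r \<odot>\<^bsub>B\<^esub> f x"
  using left_module_hom by (auto simp: left_module_hom_def)

text \<open>Serves two purposes: pushing a submodule of an extension forward to the quotient term,
  and recognising the relation of a pushout as the image of a map.\<close>

lemma submodule_image:
  assumes "submodule H R A"
  shows "submodule (f ` H) R B"
proof -
  interpret H: abelian_subgroup H A
    using assms by (rule A.submodule_abelian_subgroup)
  have sub: "\<And>x. x \<in> H \<Longrightarrow> x \<in> carrier A"
    using H.a_subset by blast
  note sc = submodule.smult_closed[OF assms]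
  show ?thesis
  proof (rule B.submoduleI)
    show "\<zero>\<^bsub>B\<^esub> \<in> f ` H"
      by (rule image_eqI[of _ _ "\<zero>\<^bsub>A\<^esub>"]) auto
  next
    fix x assume "x \<in> f ` H"
    then obtain u where u: "x = f u" "u \<in> H" by blast
    then show "\<ominus>\<^bsub>B\<^esub> x \<in> f ` H"
      by (intro image_eqI[of _ _ "\<ominus>\<^bsub>A\<^esub> u"]) (auto simp: sub)
    show "r \<odot>\<^bsub>B\<^esub> x \<in> f ` H" if "r \<in> carrier R" for r
      using u that by (intro image_eqI[of _ _ "r \<odot>\<^bsub>A\<^esub> u"]) (auto simp: sub sc)
    fix y assume "y \<in> f ` H"
    then obtain v where v: "y = f v" "v \<in> H" by blast
    then show "x \<oplus>\<^bsub>B\<^esub> y \<in> f ` H"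
      using u by (intro image_eqI[of _ _ "u \<oplus>\<^bsub>A\<^esub> v"]) (auto simp: sub)
  qed (auto simp: sub)
qed

text \<open>Lets a submodule of the target be tested against generators of the source: if its
  preimage contains them, the preimage is everything.\<close>

lemma submodule_vimage:
  assumes "submodule H R B"
  shows "submodule {x \<in> carrier A. f x \<in> H} R A"
proof -
  interpret H: abelian_subgroup H B
    using assms by (rule B.submodule_abelian_subgroup)
  show ?thesis
    by (rule A.submoduleI) (auto simp: submodule.smult_closed[OF assms])
qed

end

lemma left_module_homI:
  assumes "\<And>x. x \<in> carrier A \<Longrightarrow> f x \<in> carrier B"
    and "\<And>x y. x \<in> carrier A \<Longrightarrow> y \<in> carrier A \<Longrightarrow> f (x \<oplus>\<^bsub>A\<^esub> y) = f x \<oplus>\<^bsub>B\<^esub> f y"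
    and "\<And>r x. r \<in> carrier R \<Longrightarrow> x \<in> carrier A \<Longrightarrow> f (r \<odot>\<^bsub>A\<^esub> x) = r \<odot>\<^bsub>B\<^esub> f x"
  shows "f \<in> left_module_hom R A B"
  using assms by (auto simp: left_module_hom_def hom_def)

lemma left_module_mapI:
  assumes "left_module R A" "left_module R B" "f \<in> left_module_hom R A B"
  shows "left_module_map R A B f"
  using assms by (simp add: left_module_map_def left_module_map_axioms_def)

section \<open>Finite generation of images and extensions\<close>

lemma fg_left_module_image:
  assumes "fg_left_module R A" "left_module R B" "f \<in> left_module_hom R A B"
    and surj: "f ` carrier A = carrier B"
  shows "fg_left_module R B"
proof -
  obtain X where X: "finite X" "X \<subseteq> carrier A"
      "\<And>N. submodule N R A \<Longrightarrow> X \<subseteq> N \<Longrightarrow> N = carrier A"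
    and A: "left_module R A"
    using assms(1) by (auto simp: fg_left_module_def)
  interpret left_module_map R A B f
    using A assms by (intro left_module_mapI)
  have "N = carrier B" if N: "submodule N R B" "f ` X \<subseteq> N" for N
  proof
    show "N \<subseteq> carrier B"
      using B.submodule_abelian_subgroup[OF N(1)]
      by (auto simp: abelian_subgroup_def dest: additive_subgroup.a_subset)
    have "{x \<in> carrier A. f x \<in> N} = carrier A"
      using X(2) N by (intro X(3) submodule_vimage) auto
    then show "carrier B \<subseteq> N"
      by (auto simp: surj[symmetric])
  qed
  then show ?thesis
    using X assms(2) unfolding fg_left_module_def by (intro conjI exI[of _ "f ` X"]) auto
qed

text \<open>Generators of \<open>B\<close> are the images of the generators \<open>X\<close> of
  \<open>A\<close> together with a finite set \<open>Y\<close> of lifts of the generators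
  \<open>Z\<close> of \<open>C\<close>. A submodule \<open>N\<close> containing them contains the
  image of \<open>f\<close>, which is the kernel of \<open>g\<close>, and maps onto
  \<open>C\<close>. Hence any \<open>b\<close> has the same image as some \<open>n\<close> in
  \<open>N\<close>, and their difference lies in the kernel and so in \<open>N\<close>.\<close>

lemma fg_left_module_extension:
  assumes "fg_left_module R A" "left_module R B" "fg_left_module R C"
    and "f \<in> left_module_hom R A B" "g \<in> left_module_hom R B C"
    and exact: "exact_at A f B g C" and surj: "g ` carrier B = carrier C"
  shows "fg_left_module R B"
proof -
  obtain X where X: "finite X" "X \<subseteq> carrier A"
      "\<And>N. submodule N R A \<Longrightarrow> X \<subseteq> N \<Longrightarrow> N = carrier A"
    and A: "left_module R A"
    using assms(1) by (auto simp: fg_left_module_def)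
  obtain Z where Z: "finite Z" "Z \<subseteq> carrier C"
      "\<And>N. submodule N R C \<Longrightarrow> Z \<subseteq> N \<Longrightarrow> N = carrier C"
    and C: "left_module R C"
    using assms(3) by (auto simp: fg_left_module_def)
  interpret f: left_module_map R A B f
    using A assms by (intro left_module_mapI)
  interpret g: left_module_map R B C g
    using C assms by (intro left_module_mapI)
  obtain Y where Y: "finite Y" "Y \<subseteq> carrier B" "Z = g ` Y"
    using Z surj finite_subset_image by metis
  have "N = carrier B" if N: "submodule N R B" "f ` X \<union> Y \<subseteq> N" for N
  proof -
    interpret N: abelian_subgroup N B
      using N(1) by (rule f.B.submodule_abelian_subgroup)
    have "{x \<in> carrier A. f x \<in> N} = carrier A"
      using X(2) N by (intro X(3) f.submodule_vimage) auto
    then have ker: "a_kernel B C g \<subseteq> N"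
      unfolding exact[unfolded exact_at_def, symmetric] by auto
    have img: "g ` N = carrier C"
      using Y(3) N by (intro Z(3) g.submodule_image) auto
    have "b \<in> N" if b: "b \<in> carrier B" for b
    proof -
      obtain n where n: "n \<in> N" "g b = g n"
        using img b g.hom_closed by (metis imageE)
      then have nB: "n \<in> carrier B"
        using N.a_subset by blast
      have "b \<ominus>\<^bsub>B\<^esub> n \<in> a_kernel B C g"
        using b n nB by (simp add: a_kernel_def' a_minus_def g.B.M.r_neg)
      then have "b \<ominus>\<^bsub>B\<^esub> n \<oplus>\<^bsub>B\<^esub> n \<in> N"
        using ker n by blast
      then show ?thesis
        using b nB by (simp add: a_minus_def f.B.M.a_assoc f.B.M.l_neg)
    qed
    then show ?thesis
      using N.a_subset by blast
  qed
  then show ?thesis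
    using X Y assms(2) unfolding fg_left_module_def
    by (intro conjI exI[of _ "f ` X \<union> Y"]) auto
qed

section \<open>Direct sums\<close>

lemma module_sum_sel [simp]:
  "carrier (module_sum M N) = carrier M \<times> carrier N"
  "\<zero>\<^bsub>module_sum M N\<^esub> = (\<zero>\<^bsub>M\<^esub>, \<zero>\<^bsub>N\<^esub>)"
  "(x, y) \<oplus>\<^bsub>module_sum M N\<^esub> (x', y') = (x \<oplus>\<^bsub>M\<^esub> x', y \<oplus>\<^bsub>N\<^esub> y')"
  "r \<odot>\<^bsub>module_sum M N\<^esub> (x, y) = (r \<odot>\<^bsub>M\<^esub> x, r \<odot>\<^bsub>N\<^esub> y)"
  by (simp_all add: module_sum_def)

lemma left_module_module_sum:
  assumes "left_module R M" "left_module R N"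
  shows "left_module R (module_sum M N)"
proof -
  interpret M: left_module R M by fact
  interpret N: left_module R N by fact
  have "abelian_group (module_sum M N)"
  proof (rule abelian_groupI)
    fix u assume "u \<in> carrier (module_sum M N)"
    then show "\<exists>v\<in>carrier (module_sum M N). v \<oplus>\<^bsub>module_sum M N\<^esub> u = \<zero>\<^bsub>module_sum M N\<^esub>"
      by (intro bexI[of _ "(\<ominus>\<^bsub>M\<^esub> fst u, \<ominus>\<^bsub>N\<^esub> snd u)"]) (auto simp: M.M.l_neg N.M.l_neg)
  qed (auto simp: M.M.a_assoc N.M.a_assoc intro: M.M.a_comm N.M.a_comm)
  then show ?thesis
    by (intro left_module.intro left_module_axioms.intro M.R.ring_axioms)
      (auto simp: M.smult_l_distr M.smult_r_distr M.smult_assoc1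
        N.smult_l_distr N.smult_r_distr N.smult_assoc1)
qed

lemma module_sum_minus:
  assumes "left_module R M" "left_module R N" "x \<in> carrier M" "y \<in> carrier N"
  shows "\<ominus>\<^bsub>module_sum M N\<^esub> (x, y) = (\<ominus>\<^bsub>M\<^esub> x, \<ominus>\<^bsub>N\<^esub> y)"
proof -
  interpret M: left_module R M by fact
  interpret N: left_module R N by fact
  interpret MN: left_module R "module_sum M N"
    using assms(1,2) by (rule left_module_module_sum)
  show ?thesis
    using assms by (intro MN.M.minus_equality) (auto simp: M.M.l_neg N.M.l_neg)
qed

text \<open>The direct sum is an extension of its second summand by its first.\<close>

lemma fg_left_module_module_sum:
  assumes "fg_left_module R M" "fg_left_module R N"
  shows "fg_left_module R (module_sum M N)"
proof -
  interpret M: left_module R M using assms(1) by (simp add: fg_left_module_def)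
  interpret N: left_module R N using assms(2) by (simp add: fg_left_module_def)
  show ?thesis
  proof (rule fg_left_module_extension)
    show "left_module R (module_sum M N)"
      by (intro left_module_module_sum M.left_module_axioms N.left_module_axioms)
    show "(\<lambda>x. (x, \<zero>\<^bsub>N\<^esub>)) \<in> left_module_hom R M (module_sum M N)"
      by (intro left_module_homI) auto
    show "snd \<in> left_module_hom R (module_sum M N) N"
      by (intro left_module_homI) auto
    show "exact_at M (\<lambda>x. (x, \<zero>\<^bsub>N\<^esub>)) (module_sum M N) snd N"
      by (auto simp: exact_at_def a_kernel_def')
    show "snd ` carrier (module_sum M N) = carrier N"
      by auto
  qed (use assms in auto)
qed

section \<open>Quotient modules and their universal property\<close>

context left_module
begin

context
  fixes N assumes sub: "submodule N R M"
begin

interpretation N: abelian_subgroup N M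
  using sub by (rule submodule_abelian_subgroup)

text \<open>Turns equality of cosets into a membership test. Both the well-definedness of the scalar
  action and the computations in the pushout rest on it.\<close>

lemma coset_eq_iff:
  assumes "x \<in> carrier M" "y \<in> carrier M"
  shows "N +>\<^bsub>M\<^esub> x = N +>\<^bsub>M\<^esub> y \<longleftrightarrow> x \<ominus>\<^bsub>M\<^esub> y \<in> N"
proof
  assume "N +>\<^bsub>M\<^esub> x = N +>\<^bsub>M\<^esub> y"
  then have "x \<in> N +>\<^bsub>M\<^esub> y"
    using N.a_rcos_self assms by blast
  then show "x \<ominus>\<^bsub>M\<^esub> y \<in> N"
    using assms by (simp add: N.a_rcos_module a_minus_def)
next
  assume "x \<ominus>\<^bsub>M\<^esub> y \<in> N"
  then have "x \<in> N +>\<^bsub>M\<^esub> y"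
    using assms by (simp add: N.a_rcos_module a_minus_def)
  then show "N +>\<^bsub>M\<^esub> x = N +>\<^bsub>M\<^esub> y"
    using N.a_repr_independence' assms by blast
qed


text \<open>Zero is written as a coset of zero rather than as \<open>N\<close>, so that every
  element has the shape to which the rules for addition and scalars apply.\<close>

lemma quotient_module_sel:
  "carrier (quotient_module M N) = (\<lambda>x. N +>\<^bsub>M\<^esub> x) ` carrier M"
  "\<zero>\<^bsub>quotient_module M N\<^esub> = N +>\<^bsub>M\<^esub> \<zero>\<^bsub>M\<^esub>"
  by (simp_all add: quotient_module_def A_RCOSETS_def' N.a_subset UNION_singleton_eq_range)

lemma quotient_module_add:
  assumes "x \<in> carrier M" "y \<in> carrier M"
  shows "(N +>\<^bsub>M\<^esub> x) \<oplus>\<^bsub>quotient_module M N\<^esub> (N +>\<^bsub>M\<^esub> y) = N +>\<^bsub>M\<^esub> (x \<oplus>\<^bsub>M\<^esub> y)"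
  using assms by (simp add: quotient_module_def N.a_rcos_sum)

text \<open>If \<open>y\<close> and \<open>x\<close> lie in one coset, then \<open>r\<close> times
  their difference lies in \<open>N\<close>, so both give the same coset after scaling. The union in
  the definition thus runs over a nonempty constant family and collapses.\<close>

lemma quotient_module_smult:
  assumes "r \<in> carrier R" "x \<in> carrier M"
  shows "r \<odot>\<^bsub>quotient_module M N\<^esub> (N +>\<^bsub>M\<^esub> x) = N +>\<^bsub>M\<^esub> (r \<odot>\<^bsub>M\<^esub> x)"
proof -
  have "N +>\<^bsub>M\<^esub> (r \<odot>\<^bsub>M\<^esub> y) = N +>\<^bsub>M\<^esub> (r \<odot>\<^bsub>M\<^esub> x)" if y: "y \<in> N +>\<^bsub>M\<^esub> x" for y
  proof -
    have yM: "y \<in> carrier M" and "y \<oplus>\<^bsub>M\<^esub> \<ominus>\<^bsub>M\<^esub> x \<in> N"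
      using N.a_elemrcos_carrier[OF assms(2) y] N.a_rcos_module_imp[OF assms(2) y] by simp_all
    then have "r \<odot>\<^bsub>M\<^esub> (y \<oplus>\<^bsub>M\<^esub> \<ominus>\<^bsub>M\<^esub> x) \<in> N"
      using assms submodule.smult_closed[OF sub] by blast
    then show ?thesis
      using yM assms by (subst coset_eq_iff) (simp_all add: a_minus_def smult_r_distr smult_r_minus)
  qed
  then have "(\<Union>y\<in>N +>\<^bsub>M\<^esub> x. N +>\<^bsub>M\<^esub> (r \<odot>\<^bsub>M\<^esub> y)) = N +>\<^bsub>M\<^esub> (r \<odot>\<^bsub>M\<^esub> x)"
    by (intro UN_constant_eq[OF N.a_rcos_self[OF assms(2)]] ballI)
  then show ?thesis
    by (simp add: quotient_module_def)
qed

lemma left_module_quotient_module: "left_module R (quotient_module M N)"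
proof -
  have "abelian_group (quotient_module M N)"
  proof (rule abelian_groupI)
    fix X assume "X \<in> carrier (quotient_module M N)"
    then obtain x where "x \<in> carrier M" "X = N +>\<^bsub>M\<^esub> x"
      by (auto simp: quotient_module_sel)
    then show "\<exists>Y\<in>carrier (quotient_module M N).
        Y \<oplus>\<^bsub>quotient_module M N\<^esub> X = \<zero>\<^bsub>quotient_module M N\<^esub>"
      by (intro bexI[of _ "N +>\<^bsub>M\<^esub> (\<ominus>\<^bsub>M\<^esub> x)"])
        (auto simp: quotient_module_sel quotient_module_add M.l_neg)
  \<comment> \<open>\<open>a_coset_add_zero\<close> would turn the coset of zero back into
    \<open>N\<close> and block \<open>quotient_module_add\<close>.\<close>
  qed (auto simp: quotient_module_sel quotient_module_add M.a_ac
      simp del: a_coset_add_zero)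
  then show ?thesis
    by (intro left_module.intro left_module_axioms.intro R.ring_axioms)
      (auto simp: quotient_module_sel quotient_module_add quotient_module_smult
        smult_l_distr smult_r_distr smult_assoc1)
qed

lemma coset_left_module_hom:
  "(\<lambda>x. N +>\<^bsub>M\<^esub> x) \<in> left_module_hom R M (quotient_module M N)"
  by (rule left_module_homI)
    (auto simp: quotient_module_sel quotient_module_add quotient_module_smult)

lemma quotient_module_lift:
  assumes "left_module R P" "h \<in> left_module_hom R M P" "\<And>x. x \<in> N \<Longrightarrow> h x = \<zero>\<^bsub>P\<^esub>"
  obtains h' where "h' \<in> left_module_hom R (quotient_module M N) P"
    and "\<And>x. x \<in> carrier M \<Longrightarrow> h' (N +>\<^bsub>M\<^esub> x) = h x"
proof -
  interpret h: left_module_map R M P h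
    using left_module_axioms assms by (intro left_module_mapI)
  define h' where "h' = (\<lambda>X. the_elem (h ` X))"
  have h': "h' (N +>\<^bsub>M\<^esub> x) = h x" if x: "x \<in> carrier M" for x
  proof -
    have "h y = h x" if "y \<in> N +>\<^bsub>M\<^esub> x" for y
      using that x assms(3) N.a_subset by (auto simp: a_r_coset_def' subset_iff)
    then have "h ` (N +>\<^bsub>M\<^esub> x) = {h x}"
      using N.a_rcos_self[OF x] by blast
    then show ?thesis
      by (simp add: h'_def)
  qed
  have "h' \<in> left_module_hom R (quotient_module M N) P"
    by (rule left_module_homI)
      (auto simp: quotient_module_sel quotient_module_add quotient_module_smult h')
  then show thesis
    using h' that by blast
qed

end

end

section \<open>Composition, pullbacks and the relation defining a pushout\<close>

lemma left_module_hom_compose: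
  assumes "f \<in> left_module_hom R A B" "g \<in> left_module_hom R B C"
  shows "(\<lambda>x. g (f x)) \<in> left_module_hom R A C"
  using assms by (auto simp: left_module_hom_def hom_def Pi_iff)

lemma module_pullback_sel [simp]:
  "carrier (module_pullback V W \<alpha> \<beta>) = {(y, z). y \<in> carrier V \<and> z \<in> carrier W \<and> \<alpha> y = \<beta> z}"
  "\<zero>\<^bsub>module_pullback V W \<alpha> \<beta>\<^esub> = (\<zero>\<^bsub>V\<^esub>, \<zero>\<^bsub>W\<^esub>)"
  "(x, y) \<oplus>\<^bsub>module_pullback V W \<alpha> \<beta>\<^esub> (x', y') = (x \<oplus>\<^bsub>V\<^esub> x', y \<oplus>\<^bsub>W\<^esub> y')"
  "r \<odot>\<^bsub>module_pullback V W \<alpha> \<beta>\<^esub> (x, y) = (r \<odot>\<^bsub>V\<^esub> x, r \<odot>\<^bsub>W\<^esub> y)"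
  by (simp_all add: module_pullback_def)

lemma left_module_module_pullback:
  assumes "left_module_map R V S \<alpha>" "left_module_map R W S \<beta>"
  shows "left_module R (module_pullback V W \<alpha> \<beta>)"
proof -
  interpret \<alpha>: left_module_map R V S \<alpha> by fact
  interpret \<beta>: left_module_map R W S \<beta> by fact
  interpret VW: left_module R "module_sum V W"
    by (intro left_module_module_sum \<alpha>.A.left_module_axioms \<beta>.A.left_module_axioms)
  show ?thesis
    unfolding module_pullback_def
    by (intro VW.submodule_left_module VW.submoduleI)
      (auto simp: module_sum_minus[OF \<alpha>.A.left_module_axioms \<beta>.A.left_module_axioms])
qed

text \<open>The relation is the image of \<open>S\<close> under the map that sends \<open>t\<close>
  to (\<alpha> t, -\<beta> t), which is itself a module homomorphism into the direct sum.\<close>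

lemma submodule_module_pushout_relation:
  assumes "left_module_map R S V \<alpha>" "left_module_map R S W \<beta>"
  shows "submodule {(\<alpha> t, \<ominus>\<^bsub>W\<^esub> \<beta> t) | t. t \<in> carrier S} R (module_sum V W)"
proof -
  interpret \<alpha>: left_module_map R S V \<alpha> by fact
  interpret \<beta>: left_module_map R S W \<beta> by fact
  interpret \<gamma>: left_module_map R S "module_sum V W" "\<lambda>t. (\<alpha> t, \<ominus>\<^bsub>W\<^esub> \<beta> t)"
    by (intro left_module_mapI left_module_module_sum left_module_homI
        \<alpha>.A.left_module_axioms \<alpha>.B.left_module_axioms \<beta>.B.left_module_axioms)
      (auto simp: \<beta>.B.M.minus_add \<beta>.B.smult_r_minus)
  have "submodule (carrier S) R S"
    by (rule \<alpha>.A.submoduleI) auto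
  then show ?thesis
    using \<gamma>.submodule_image by (simp only: setcompr_eq_image Collect_mem_eq)
qed


section \<open>The four-term exact sequence\<close>

theorem lemma3p2:
  fixes G :: "('g, 'gx) monoid_scheme"
    and k :: "('k, 'kx) ring_scheme"
    and p :: nat
    and S :: "('g \<Rightarrow> 'k, 's) module"
    and S\<^sub>1 :: "('g \<Rightarrow> 'k, 's1) module"
    and S\<^sub>2 :: "('g \<Rightarrow> 'k, 's2) module"
    and T :: "('g \<Rightarrow> 'k, 't) module"
    and V\<^sub>0 :: "('g \<Rightarrow> 'k, 'v0) module"
    and V\<^sub>1 :: "('g \<Rightarrow> 'k, 'v1) module"
    and V\<^sub>2 :: "('g \<Rightarrow> 'k, 'v2) module"
    and \<alpha>\<^sub>0 \<beta>\<^sub>0 \<alpha>\<^sub>1 \<beta>\<^sub>1 \<alpha>\<^sub>2 \<beta>\<^sub>2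
  defines "kG \<equiv> group_algebra k G"
  defines "W\<^sub>1 \<equiv> module_pushout S\<^sub>1 V\<^sub>0 V\<^sub>1 \<alpha>\<^sub>0 \<alpha>\<^sub>1"
  defines "W\<^sub>2 \<equiv> module_pullback V\<^sub>1 V\<^sub>2 \<beta>\<^sub>1 \<beta>\<^sub>2"
  assumes "group G" and "finite (carrier G)"
    and "Factorial_Ring.prime p" and "field k" and "ring_char k = p"
    and "fg_left_module kG S" and "fg_left_module kG S\<^sub>1" and "fg_left_module kG S\<^sub>2"
    and "fg_left_module kG T"
    and "fg_left_module kG V\<^sub>0" and "fg_left_module kG V\<^sub>1" and "fg_left_module kG V\<^sub>2"
    and "short_exact kG S\<^sub>1 \<alpha>\<^sub>0 V\<^sub>0 \<beta>\<^sub>0 S"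
    and "short_exact kG S\<^sub>1 \<alpha>\<^sub>1 V\<^sub>1 \<beta>\<^sub>1 S\<^sub>2"
    and "short_exact kG T \<alpha>\<^sub>2 V\<^sub>2 \<beta>\<^sub>2 S\<^sub>2"
  shows "fg_left_module kG W\<^sub>1 \<and> fg_left_module kG W\<^sub>2 \<and>
    (\<exists>f g h. long_exact4 kG T f W\<^sub>2 g W\<^sub>1 h S)"
proof -
  have mods: "left_module kG S" "left_module kG S\<^sub>1" "left_module kG S\<^sub>2" "left_module kG T"
      "left_module kG V\<^sub>0" "left_module kG V\<^sub>1" "left_module kG V\<^sub>2"
    using assms by (simp_all add: fg_left_module_def)
  have homs: "\<alpha>\<^sub>0 \<in> left_module_hom kG S\<^sub>1 V\<^sub>0" "\<beta>\<^sub>0 \<in> left_module_hom kG V\<^sub>0 S"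
      "\<alpha>\<^sub>1 \<in> left_module_hom kG S\<^sub>1 V\<^sub>1" "\<beta>\<^sub>1 \<in> left_module_hom kG V\<^sub>1 S\<^sub>2"
      "\<alpha>\<^sub>2 \<in> left_module_hom kG T V\<^sub>2" "\<beta>\<^sub>2 \<in> left_module_hom kG V\<^sub>2 S\<^sub>2"
    and ex: "{\<zero>\<^bsub>S\<^sub>1\<^esub>} = a_kernel S\<^sub>1 V\<^sub>0 \<alpha>\<^sub>0" "\<alpha>\<^sub>0 ` carrier S\<^sub>1 = a_kernel V\<^sub>0 S \<beta>\<^sub>0"
      "\<alpha>\<^sub>1 ` carrier S\<^sub>1 = a_kernel V\<^sub>1 S\<^sub>2 \<beta>\<^sub>1"
      "{\<zero>\<^bsub>T\<^esub>} = a_kernel T V\<^sub>2 \<alpha>\<^sub>2" "\<alpha>\<^sub>2 ` carrier T = a_kernel V\<^sub>2 S\<^sub>2 \<beta>\<^sub>2"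
    and surj: "\<beta>\<^sub>0 ` carrier V\<^sub>0 = carrier S" "\<beta>\<^sub>1 ` carrier V\<^sub>1 = carrier S\<^sub>2"
      "\<beta>\<^sub>2 ` carrier V\<^sub>2 = carrier S\<^sub>2"
    using assms by (simp_all add: short_exact_def exact_at_def)
  interpret \<alpha>0: left_module_map kG S\<^sub>1 V\<^sub>0 \<alpha>\<^sub>0 by (intro left_module_mapI mods homs)
  interpret \<beta>0: left_module_map kG V\<^sub>0 S \<beta>\<^sub>0 by (intro left_module_mapI mods homs)
  interpret \<alpha>1: left_module_map kG S\<^sub>1 V\<^sub>1 \<alpha>\<^sub>1 by (intro left_module_mapI mods homs)
  interpret \<beta>1: left_module_map kG V\<^sub>1 S\<^sub>2 \<beta>\<^sub>1 by (intro left_module_mapI mods homs)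
  interpret \<alpha>2: left_module_map kG T V\<^sub>2 \<alpha>\<^sub>2 by (intro left_module_mapI mods homs)
  interpret \<beta>2: left_module_map kG V\<^sub>2 S\<^sub>2 \<beta>\<^sub>2 by (intro left_module_mapI mods homs)

  have W2: "left_module kG W\<^sub>2"
    unfolding W\<^sub>2_def
    by (rule left_module_module_pullback[OF \<beta>1.left_module_map_axioms \<beta>2.left_module_map_axioms])
  have \<beta>\<alpha>1: "\<beta>\<^sub>1 (\<alpha>\<^sub>1 t) = \<zero>\<^bsub>S\<^sub>2\<^esub>" if "t \<in> carrier S\<^sub>1" for t
    using ex(3) that by (auto simp: a_kernel_def')
  have \<beta>\<alpha>2: "\<beta>\<^sub>2 (\<alpha>\<^sub>2 t) = \<zero>\<^bsub>S\<^sub>2\<^esub>" if "t \<in> carrier T" for t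
    using ex(5) that by (auto simp: a_kernel_def')
  \<comment> \<open>The kernel of \<open>snd\<close> consists of the pairs (y, 0) with y in the
    kernel of \<open>\<beta>\<^sub>1\<close>, that is, in the image of
    \<open>\<alpha>\<^sub>1\<close>. That \<open>snd\<close> is onto follows from surjectivity of
    \<open>\<beta>\<^sub>1\<close>.\<close>
  have fgW2: "fg_left_module kG W\<^sub>2"
  proof (rule fg_left_module_extension)
    show "(\<lambda>t. (\<alpha>\<^sub>1 t, \<zero>\<^bsub>V\<^sub>2\<^esub>)) \<in> left_module_hom kG S\<^sub>1 W\<^sub>2"
      unfolding W\<^sub>2_def by (intro left_module_homI) (auto simp: \<beta>\<alpha>1)
    show "snd \<in> left_module_hom kG W\<^sub>2 V\<^sub>2"
      unfolding W\<^sub>2_def by (intro left_module_homI) auto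
    have "(y, \<zero>\<^bsub>V\<^sub>2\<^esub>) \<in> (\<lambda>t. (\<alpha>\<^sub>1 t, \<zero>\<^bsub>V\<^sub>2\<^esub>)) ` carrier S\<^sub>1"
      if "y \<in> carrier V\<^sub>1" "\<beta>\<^sub>1 y = \<zero>\<^bsub>S\<^sub>2\<^esub>" for y
    proof -
      have "y \<in> \<alpha>\<^sub>1 ` carrier S\<^sub>1"
        using that by (simp add: ex(3) a_kernel_def')
      then show ?thesis by blast
    qed
    then show "exact_at S\<^sub>1 (\<lambda>t. (\<alpha>\<^sub>1 t, \<zero>\<^bsub>V\<^sub>2\<^esub>)) W\<^sub>2 snd V\<^sub>2"
      unfolding W\<^sub>2_def exact_at_def a_kernel_def' by (auto simp: \<beta>\<alpha>1)
    have "\<exists>y\<in>carrier V\<^sub>1. \<beta>\<^sub>1 y = \<beta>\<^sub>2 z" if "z \<in> carrier V\<^sub>2" for z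
      using that surj(2) \<beta>2.hom_closed by (metis imageE)
    then show "snd ` carrier W\<^sub>2 = carrier V\<^sub>2"
      unfolding W\<^sub>2_def by (force simp: image_iff)
  qed (use assms W2 in auto)

  define V where "V = module_sum V\<^sub>0 V\<^sub>1"
  define N where "N = {(\<alpha>\<^sub>0 t, \<ominus>\<^bsub>V\<^sub>1\<^esub> \<alpha>\<^sub>1 t) | t. t \<in> carrier S\<^sub>1}"
  \<comment> \<open>\<open>q\<close> is the projection of the direct sum onto the pushout. Elements
    of the pushout are handled as values of \<open>q\<close> and compared through
    \<open>q_eq\<close>.\<close>
  define q where "q = (\<lambda>v. N +>\<^bsub>V\<^esub> v)"
  have W1_eq: "W\<^sub>1 = quotient_module V N"
    by (simp add: W\<^sub>1_def module_pushout_def V_def N_def)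
  have carrV: "carrier V = carrier V\<^sub>0 \<times> carrier V\<^sub>1"
    by (simp add: V_def)
  interpret V: left_module kG V
    unfolding V_def by (intro left_module_module_sum mods)
  have N: "submodule N kG V"
    unfolding N_def V_def
    by (intro submodule_module_pushout_relation \<alpha>0.left_module_map_axioms \<alpha>1.left_module_map_axioms)
  note W1 = V.left_module_quotient_module[OF N, folded W1_eq]
  have q: "q \<in> left_module_hom kG V W\<^sub>1"
    using V.coset_left_module_hom[OF N] by (simp add: q_def W1_eq)
  have carrW1: "carrier W\<^sub>1 = q ` carrier V"
    by (simp add: W1_eq q_def V.quotient_module_sel[OF N])
  have q_eq: "q (x, y) = q (x', y') \<longleftrightarrow> (x \<ominus>\<^bsub>V\<^sub>0\<^esub> x', y \<ominus>\<^bsub>V\<^sub>1\<^esub> y') \<in> N"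
    if "(x, y) \<in> carrier V" "(x', y') \<in> carrier V" for x y x' y'
    using V.coset_eq_iff[OF N that] that
    by (simp add: q_def a_minus_def V_def module_sum_minus[OF mods(5,6)])
  \<comment> \<open>With zero as a value of \<open>q\<close>, \<open>q_eq\<close> also decides when
    a class vanishes. The restricted first simplification keeps the coset of zero from being
    contracted to \<open>N\<close>.\<close>
  have zeroW1: "\<zero>\<^bsub>W\<^sub>1\<^esub> = q (\<zero>\<^bsub>V\<^sub>0\<^esub>, \<zero>\<^bsub>V\<^sub>1\<^esub>)"
    by (simp only: W1_eq q_def V.quotient_module_sel[OF N]) (simp add: V_def)
  have fgW1: "fg_left_module kG W\<^sub>1"
  proof (rule fg_left_module_image[OF _ W1 q])
    show "fg_left_module kG V"
      unfolding V_def using assms by (intro fg_left_module_module_sum) auto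
  qed (simp add: carrW1)

  define f where "f = (\<lambda>t. (\<zero>\<^bsub>V\<^sub>1\<^esub>, \<alpha>\<^sub>2 t))"
  define g where "g = (\<lambda>w :: 'v1 \<times> 'v2. q (\<zero>\<^bsub>V\<^sub>0\<^esub>, fst w))"
  have f: "f \<in> left_module_hom kG T W\<^sub>2"
    unfolding W\<^sub>2_def f_def by (intro left_module_homI) (auto simp: \<beta>\<alpha>2)
  have "(\<lambda>w. (\<zero>\<^bsub>V\<^sub>0\<^esub>, fst w)) \<in> left_module_hom kG W\<^sub>2 V"
    unfolding W\<^sub>2_def V_def by (intro left_module_homI) auto
  then have g: "g \<in> left_module_hom kG W\<^sub>2 W\<^sub>1"
    unfolding g_def using q by (rule left_module_hom_compose)
  \<comment> \<open>The map \<open>h\<close> arises by factoring this map through the quotient: it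
    kills \<open>N\<close> because \<open>\<beta>\<^sub>0\<close> vanishes on the image of
    \<open>\<alpha>\<^sub>0\<close>.\<close>
  have "(\<lambda>v. \<beta>\<^sub>0 (fst v)) \<in> left_module_hom kG V S"
    unfolding V_def by (intro left_module_homI) auto
  moreover have \<beta>\<alpha>0: "\<beta>\<^sub>0 (\<alpha>\<^sub>0 t) = \<zero>\<^bsub>S\<^esub>" if "t \<in> carrier S\<^sub>1" for t
    using ex(2) that by (auto simp: a_kernel_def')
  then have "\<beta>\<^sub>0 (fst v) = \<zero>\<^bsub>S\<^esub>" if "v \<in> N" for v
    using that by (auto simp: N_def)
  ultimately obtain h where h: "h \<in> left_module_hom kG W\<^sub>1 S"
    and hq: "\<And>v. v \<in> carrier V \<Longrightarrow> h (q v) = \<beta>\<^sub>0 (fst v)"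
    using V.quotient_module_lift[OF N mods(1), folded W1_eq] unfolding q_def by metis

  \<comment> \<open>The map from \<open>V\<^sub>1\<close> to the pushout is injective: (0, y) lies
    in \<open>N\<close> only if y is the negative of \<open>\<alpha>\<^sub>1 t\<close> for some t
    killed by \<open>\<alpha>\<^sub>0\<close>, and injectivity of \<open>\<alpha>\<^sub>0\<close>
    makes t zero.\<close>
  have g_zero: "q (\<zero>\<^bsub>V\<^sub>0\<^esub>, y) = \<zero>\<^bsub>W\<^sub>1\<^esub> \<longleftrightarrow> y = \<zero>\<^bsub>V\<^sub>1\<^esub>" if y: "y \<in> carrier V\<^sub>1" for y
  proof -
    have "q (\<zero>\<^bsub>V\<^sub>0\<^esub>, y) = \<zero>\<^bsub>W\<^sub>1\<^esub> \<longleftrightarrow> (\<zero>\<^bsub>V\<^sub>0\<^esub>, y) \<in> N"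
      using y by (simp add: zeroW1 q_eq carrV a_minus_def)
    also have "\<dots> \<longleftrightarrow> (\<exists>t\<in>a_kernel S\<^sub>1 V\<^sub>0 \<alpha>\<^sub>0. y = \<ominus>\<^bsub>V\<^sub>1\<^esub> \<alpha>\<^sub>1 t)"
      by (simp add: N_def a_kernel_def') metis
    also have "\<dots> \<longleftrightarrow> y = \<zero>\<^bsub>V\<^sub>1\<^esub>"
      by (simp add: ex(1)[symmetric])
    finally show ?thesis .
  qed
  have "long_exact4 kG T f W\<^sub>2 g W\<^sub>1 h S"
    unfolding long_exact4_def
  proof (intro conjI f g h)
    show "{\<zero>\<^bsub>T\<^esub>} = a_kernel T W\<^sub>2 f"
      using ex(4) by (simp add: a_kernel_def' f_def W\<^sub>2_def)
    show "exact_at T f W\<^sub>2 g W\<^sub>1"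
      unfolding exact_at_def
    proof
      show "f ` carrier T \<subseteq> a_kernel W\<^sub>2 W\<^sub>1 g"
        by (auto simp: f_def g_def a_kernel_def' zeroW1[symmetric] W\<^sub>2_def \<beta>\<alpha>2)
      show "a_kernel W\<^sub>2 W\<^sub>1 g \<subseteq> f ` carrier T"
      proof
        \<comment> \<open>By \<open>g_zero\<close> the first component of \<open>w\<close> is zero,
          so the pullback condition puts the second into the kernel of
          \<open>\<beta>\<^sub>2\<close>, which is the image of
          \<open>\<alpha>\<^sub>2\<close>.\<close>
        fix w assume "w \<in> a_kernel W\<^sub>2 W\<^sub>1 g"
        then obtain z where z: "w = (\<zero>\<^bsub>V\<^sub>1\<^esub>, z)" "z \<in> carrier V\<^sub>2" "\<beta>\<^sub>2 z = \<zero>\<^bsub>S\<^sub>2\<^esub>"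
          by (auto simp: g_def a_kernel_def' g_zero W\<^sub>2_def)
        then have "z \<in> \<alpha>\<^sub>2 ` carrier T"
          by (simp add: ex(5) a_kernel_def')
        then show "w \<in> f ` carrier T"
          by (auto simp: f_def z)
      qed
    qed
    show "exact_at W\<^sub>2 g W\<^sub>1 h S"
      unfolding exact_at_def
    proof
      show "g ` carrier W\<^sub>2 \<subseteq> a_kernel W\<^sub>1 S h"
        by (auto simp: g_def a_kernel_def' W\<^sub>2_def carrW1 carrV hq)
      show "a_kernel W\<^sub>1 S h \<subseteq> g ` carrier W\<^sub>2"
      proof
        fix u assume "u \<in> a_kernel W\<^sub>1 S h"
        then obtain x y where u: "u = q (x, y)" and xy: "x \<in> carrier V\<^sub>0" "y \<in> carrier V\<^sub>1"
          and "\<beta>\<^sub>0 x = \<zero>\<^bsub>S\<^esub>"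
          by (auto simp: a_kernel_def' carrW1 carrV hq)
        then have "x \<in> \<alpha>\<^sub>0 ` carrier S\<^sub>1"
          by (simp add: ex(2) a_kernel_def')
        then obtain t where t: "t \<in> carrier S\<^sub>1" "x = \<alpha>\<^sub>0 t" by blast
        \<comment> \<open>Subtracting the relation (\<open>\<alpha>\<^sub>0 t\<close>,
          \<open>- \<alpha>\<^sub>1 t\<close>) from (x, y) clears the first component and leaves (0,
          y'), a representative of the same class.\<close>
        define y' where "y' = y \<oplus>\<^bsub>V\<^sub>1\<^esub> \<alpha>\<^sub>1 t"
        have y': "y' \<in> carrier V\<^sub>1"
          using xy t by (simp add: y'_def)
        have "y \<ominus>\<^bsub>V\<^sub>1\<^esub> y' = \<ominus>\<^bsub>V\<^sub>1\<^esub> \<alpha>\<^sub>1 t"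
          using xy t by (simp add: y'_def a_minus_def \<alpha>1.B.M.minus_add \<alpha>1.B.M.r_neg2)
        then have "(x \<ominus>\<^bsub>V\<^sub>0\<^esub> \<zero>\<^bsub>V\<^sub>0\<^esub>, y \<ominus>\<^bsub>V\<^sub>1\<^esub> y') \<in> N"
          using t by (auto simp: N_def a_minus_def)
        then have u': "u = q (\<zero>\<^bsub>V\<^sub>0\<^esub>, y')"
          using xy y' by (simp add: u q_eq carrV)
        \<comment> \<open>Surjectivity of \<open>\<beta>\<^sub>2\<close> completes y' to an element
          of the pullback; \<open>g\<close> depends only on y', so any such z will do.\<close>
        obtain z where "z \<in> carrier V\<^sub>2" "\<beta>\<^sub>1 y' = \<beta>\<^sub>2 z"
          using y' surj(3) \<beta>1.hom_closed by (metis imageE)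
        then show "u \<in> g ` carrier W\<^sub>2"
          using y' by (intro image_eqI[of _ _ "(y', z)"]) (auto simp: u' g_def W\<^sub>2_def)
      qed
    qed
    \<comment> \<open>Each x in \<open>V\<^sub>0\<close> occurs as a first component, for instance
      in (x, 0); this is where the zero of \<open>V\<^sub>1\<close> enters.\<close>
    have "h ` carrier W\<^sub>1 = \<beta>\<^sub>0 ` carrier V\<^sub>0"
      unfolding carrW1 image_image carrV using \<alpha>1.B.M.zero_closed
      by (force simp: hq carrV image_iff)
    then show "h ` carrier W\<^sub>1 = carrier S"
      using surj(1) by simp
  qed
  then show ?thesis
    using fgW1 fgW2 by blast
qed

end
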